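(* Suppose that $A$ is a closed subspace of a locally compact Polish space $X$, that $P$ is a polyhedron, and let $I=[0,1]$. Then for every continuous map $g:(A\times I)\cup(X\times\{0\})\to P$ there exists a continuous map $\tilde g:X\times I\to P$ which extends $g$. Furthermore, $\tilde g$ can be chosen in a Borel fashion from $g$: there is a Borel function $$\mathrm{Map}\big((A\times I)\cup(X\times\{0\}),P\big)\to\mathrm{Map}(X\times I,P),\qquad g\mapsto\tilde g,$$ such that $\tilde g$ extends $g$ for every $g$.
   Context: A polyhedron is a space homeomorphic to the topological realization of a countable, locally finite simplicial complex. $\mathrm{Map}(Y,P)$ is the set of continuous maps $Y\to P$ with the compact-open topology; it is a Polish space when $Y$ is a locally compact Polish space. *)

theory Defs
  imports "HOL-Analysis.Analysis"
begin

definition abstract_simplicial_complex :: "'v set set \<Rightarrow> bool" where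
  "abstract_simplicial_complex K \<longleftrightarrow>
     (\<forall>s\<in>K. finite s \<and> s \<noteq> {}) \<and> (\<forall>s\<in>K. \<forall>t. t \<subseteq> s \<and> t \<noteq> {} \<longrightarrow> t \<in> K)"

definition locally_finite_complex :: "'v set set \<Rightarrow> bool" where
  "locally_finite_complex K \<longleftrightarrow> (\<forall>v \<in> \<Union>K. finite {s \<in> K. v \<in> s})"

text \<open>Points of the topological realization, in barycentric coordinates.\<close>

definition realization_points :: "'v set set \<Rightarrow> ('v \<Rightarrow> real) set" where
  "realization_points K =
     {x. (\<forall>v. 0 \<le> x v) \<and> {v. x v \<noteq> 0} \<in> K \<and> (\<Sum>v | x v \<noteq> 0. x v) = 1}"

definition closed_simplex :: "'v set set \<Rightarrow> 'v set \<Rightarrow> ('v \<Rightarrow> real) set" where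
  "closed_simplex K s = {x \<in> realization_points K. {v. x v \<noteq> 0} \<subseteq> s}"

text \<open>The weak topology: a set is open iff its trace on every closed simplex is open there, a closed
  simplex having the topology induced by its finitely many coordinates.\<close>

definition realization :: "'v set set \<Rightarrow> ('v \<Rightarrow> real) topology" where
  "realization K = topology (\<lambda>U. U \<subseteq> realization_points K \<and>
     (\<forall>s\<in>K. openin (subtopology (powertop_real UNIV) (closed_simplex K s))
                   (U \<inter> closed_simplex K s)))"

lemma openin_realization:
  "openin (realization K) U \<longleftrightarrow> U \<subseteq> realization_points K \<and>
     (\<forall>s\<in>K. openin (subtopology (powertop_real UNIV) (closed_simplex K s))
                   (U \<inter> closed_simplex K s))"
proof -
  have "istopology (\<lambda>U. U \<subseteq> realization_points K \<and>
     (\<forall>s\<in>K. openin (subtopology (powertop_real UNIV) (closed_simplex K s))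
                   (U \<inter> closed_simplex K s)))"
    unfolding istopology_def
  proof (intro conjI allI impI ballI)
    fix S T s
    assume S: "S \<subseteq> realization_points K \<and> (\<forall>s\<in>K. openin (subtopology (powertop_real UNIV) (closed_simplex K s)) (S \<inter> closed_simplex K s))"
      and T: "T \<subseteq> realization_points K \<and> (\<forall>s\<in>K. openin (subtopology (powertop_real UNIV) (closed_simplex K s)) (T \<inter> closed_simplex K s))"
    then show "S \<inter> T \<subseteq> realization_points K" by blast
    assume "s \<in> K"
    then have "openin (subtopology (powertop_real UNIV) (closed_simplex K s))
        ((S \<inter> closed_simplex K s) \<inter> (T \<inter> closed_simplex K s))"
      using S T by (intro openin_Int[of _ "S \<inter> _" "T \<inter> _"]) simp_all
    then show "openin (subtopology (powertop_real UNIV) (closed_simplex K s)) (S \<inter> T \<inter> closed_simplex K s)"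
      by (simp add: Int_ac)
  next
    fix \<K> s
    assume \<K>: "\<forall>S\<in>\<K>. S \<subseteq> realization_points K \<and> (\<forall>s\<in>K. openin (subtopology (powertop_real UNIV) (closed_simplex K s)) (S \<inter> closed_simplex K s))"
    then show "\<Union>\<K> \<subseteq> realization_points K" by blast
    assume "s \<in> K"
    then have "openin (subtopology (powertop_real UNIV) (closed_simplex K s)) (\<Union>S\<in>\<K>. S \<inter> closed_simplex K s)"
      using \<K> by - (rule openin_Union, erule imageE, simp)
    then show "openin (subtopology (powertop_real UNIV) (closed_simplex K s)) (\<Union>\<K> \<inter> closed_simplex K s)"
      by (simp only: Int_Union2)
  qed
  then show ?thesis
    by (simp add: realization_def topology_inverse')
qed

lemma topspace_realization: "topspace (realization K) = realization_points K"
proof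
  show "topspace (realization K) \<subseteq> realization_points K"
    using openin_realization by blast
  have "realization_points K \<inter> closed_simplex K s = closed_simplex K s" for s
    by (auto simp: closed_simplex_def)
  then have "openin (realization K) (realization_points K)"
    by (simp add: openin_realization openin_subtopology_refl)
  then show "realization_points K \<subseteq> topspace (realization K)"
    by (rule openin_subset)
qed

text \<open>Vertices of a countable complex can be taken to be natural numbers without loss of
  generality.\<close>

definition polyhedron_space :: "'b topology \<Rightarrow> bool" where
  "polyhedron_space P \<longleftrightarrow>
     (\<exists>K :: nat set set. abstract_simplicial_complex K \<and> countable K \<and> locally_finite_complex K \<and>
        P homeomorphic_space realization K)"

definition Polish_space :: "'a topology \<Rightarrow> bool" where
  "Polish_space X \<longleftrightarrow> completely_metrizable_space X \<and> second_countable X"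

text \<open>Continuous maps are represented by functions that are undefined outside the domain space, so
  that distinct elements are distinct maps.\<close>

definition Map :: "'a topology \<Rightarrow> 'b topology \<Rightarrow> ('a \<Rightarrow> 'b) set" where
  "Map Y P = {f \<in> extensional (topspace Y). continuous_map Y P f}"

definition compact_open_topology :: "'a topology \<Rightarrow> 'b topology \<Rightarrow> ('a \<Rightarrow> 'b) topology" where
  "compact_open_topology Y P =
     topology_generated_by {{f \<in> Map Y P. f ` C \<subseteq> U} | C U. compactin Y C \<and> openin P U}"

lemma topspace_compact_open_topology: "topspace (compact_open_topology Y P) = Map Y P"
proof -
  have "Map Y P = {f \<in> Map Y P. f ` {} \<subseteq> {}}"
    by simp
  then have "Map Y P \<in> {{f \<in> Map Y P. f ` C \<subseteq> U} | C U. compactin Y C \<and> openin P U}"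
    using compactin_empty openin_empty by blast
  then show ?thesis
    by (auto simp: compact_open_topology_def topology_generated_by_topspace)
qed

definition borel_of :: "'a topology \<Rightarrow> 'a measure" where
  "borel_of T = sigma (topspace T) {U. openin T U}"

lemma space_borel_of: "space (borel_of T) = topspace T"
  unfolding borel_of_def by (rule space_measure_of) (auto dest: openin_subset)

lemma sets_borel_of: "sets (borel_of T) = sigma_sets (topspace T) {U. openin T U}"
  unfolding borel_of_def by (rule sets_measure_of) (auto dest: openin_subset)

end

(*
  Composing with the evaluation map Map(Y,P) x Y -> P, which is continuous because Y is locally
  compact, turns the Borel choice into a homotopy extension problem with a parameter t in
  T = Map(Y,P); a continuous solution T x X x I -> P curries to a continuous, hence Borel,
  g |-> g~. Realize P as |K| inside the Banach space of bounded functions on the vertices. An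
  explicit weighted mean in the style of Dugundji extends the given map to a continuous G on all of
  T x X x I with values in that space. An open neighbourhood of |K| retracts onto |K| by the formula
  x |-> normalized (x - c(x))^+, where c(x) is the least level above which the superlevel sets of x
  are simplices. Where G leaves the neighbourhood the homotopy is slowed down and finally stopped.
*)

theory Submission
  imports Defs
begin

text \<open>The parameter space carries only its compact-open topology; no metric on it is
  constructed. Every auxiliary step is therefore made continuous in t over an arbitrary space T.
  This is why the weights live on X x I alone, with t entering through values at fixed points; why
  those values are uniformly bounded, so that one convergent majorant serves all t; and why minima
  over I are treated by projecting along a compact factor instead of by uniform continuity. Local
  finiteness reconciles the topologies on |K|: where one fixed coordinate is positive only finitely
  many vertices occur, so the weak topology, coordinatewise convergence and the sup norm agree
  there. Means of points of |K| may leave not only |K| but also the domain of the retraction. At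
  time 0, however, the extension equals g, so stopping a path there is always safe.\<close>

text \<open>Completeness of \<^typ>\<open>'a \<Rightarrow>\<^sub>C 'b\<close> is available in the library only for metric domains.\<close>

instantiation nat :: metric_space
begin

definition dist_nat :: "nat \<Rightarrow> nat \<Rightarrow> real"
  where "dist_nat m n = \<bar>real m - real n\<bar>"

definition uniformity_nat :: "(nat \<times> nat) filter"
  where "uniformity_nat = (INF e\<in>{0<..}. principal {(m, n). dist m n < e})"

instance
proof
  show "open U \<longleftrightarrow> (\<forall>m\<in>U. \<forall>\<^sub>F (m', n) in uniformity. m' = m \<longrightarrow> n \<in> U)" for U :: "nat set"
  proof -
    have "\<forall>\<^sub>F (m', n) in uniformity. m' = m \<longrightarrow> n \<in> U" if "m \<in> U" for m
      unfolding uniformity_nat_def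
    proof (rule eventually_INF1[of 1])
      have "m = n" if "dist m n < 1" for n
      proof -
        have "real m < real (Suc n)" "real n < real (Suc m)"
          using that unfolding dist_nat_def abs_less_iff by auto
        then show ?thesis
          by (simp only: of_nat_less_iff)
      qed
      then show "\<forall>\<^sub>F (m', n) in principal {(m, n). dist m n < 1}. m' = m \<longrightarrow> n \<in> U"
        using that by (auto simp: eventually_principal)
    qed simp
    then show ?thesis
      by (simp add: open_discrete)
  qed
qed (auto simp: dist_nat_def uniformity_nat_def)

end

instance bcontfun :: (metric_space, banach) banach ..

section \<open>Continuity criteria for maps into metric spaces\<close>

lemma continuous_map_euclidean_iff_dist:
  fixes f :: "'a \<Rightarrow> 'b::metric_space"
  shows "continuous_map X euclidean f \<longleftrightarrow>
    (\<forall>x\<in>topspace X. \<forall>\<epsilon>>0. \<exists>U. openin X U \<and> x \<in> U \<and> (\<forall>y\<in>U. dist (f x) (f y) < \<epsilon>))"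
  using Met_TC.continuous_map_to_metric[of X f]
  by (simp add: Met_TC.in_mball)

lemma openin_vimage_real:
  fixes f :: "'a \<Rightarrow> 'b::topological_space"
  assumes "continuous_map X euclidean f" "open U"
  shows "openin X {x \<in> topspace X. f x \<in> U}"
  using openin_continuous_map_preimage[OF assms(1)] assms(2) by simp

section \<open>Points and topology of the realization\<close>

lemma closed_simplex_self:
  assumes "x \<in> realization_points K"
  shows "x \<in> closed_simplex K {v. x v \<noteq> 0}"
  using assms by (simp add: closed_simplex_def)

lemma realization_point_pos:
  assumes "x \<in> realization_points K" "x v \<noteq> 0"
  shows "0 < x v"
  using assms by (auto simp: realization_points_def order_less_le)

lemma realization_point_support:
  assumes "x \<in> realization_points K"
  shows "{v. x v \<noteq> 0} \<in> K"
  using assms by (simp add: realization_points_def)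

lemma realization_point_ex_pos:
  assumes "x \<in> realization_points K"
  obtains v where "0 < x v"
proof -
  have "{v. x v \<noteq> 0} \<noteq> {}"
    using assms by (intro notI) (simp add: realization_points_def)
  then show ?thesis
    using that realization_point_pos[OF assms] by blast
qed

lemma realization_point_le_1:
  assumes "abstract_simplicial_complex K" "x \<in> realization_points K"
  shows "x v \<le> 1"
proof (cases "x v = 0")
  case False
  have "finite {v. x v \<noteq> 0}"
    using assms by (auto simp: realization_points_def abstract_simplicial_complex_def)
  then have "x v \<le> (\<Sum>v | x v \<noteq> 0. x v)"
    using False assms(2) by (intro member_le_sum) (auto simp: realization_points_def)
  then show ?thesis
    using assms(2) by (simp add: realization_points_def)
qed simp

text \<open>When \<open>v\<close> carries positive weight, these are the only vertices that can
  carry weight; local finiteness enters the norm and retraction estimates in this form.\<close>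

lemma finite_star_vertices:
  assumes "abstract_simplicial_complex K" "locally_finite_complex K"
  shows "finite (\<Union>{s \<in> K. v \<in> s})"
proof (cases "v \<in> \<Union>K")
  case True
  then have "finite {s \<in> K. v \<in> s}"
    using assms(2) unfolding locally_finite_complex_def by blast
  then show ?thesis
    using assms(1) by (auto simp: abstract_simplicial_complex_def)
next
  case False
  then have "{s \<in> K. v \<in> s} = {}"
    by blast
  then show ?thesis
    by (metis finite.emptyI Union_empty)
qed

lemma continuous_map_realization_coord:
  "continuous_map (realization K) euclideanreal (\<lambda>x. x v)"
  unfolding continuous_map
proof (intro conjI allI impI)
  fix U :: "real set"
  assume U: "openin euclideanreal U"
  have "openin (subtopology (powertop_real UNIV) (closed_simplex K s))
      ({x \<in> topspace (realization K). x v \<in> U} \<inter> closed_simplex K s)" for s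
  proof -
    have "openin (powertop_real UNIV) {x \<in> topspace (powertop_real UNIV). x v \<in> U}"
      using U by (intro openin_continuous_map_preimage[OF continuous_map_product_projection]) auto
    moreover have "{x \<in> topspace (realization K). x v \<in> U} \<inter> closed_simplex K s
       = {x \<in> topspace (powertop_real UNIV). x v \<in> U} \<inter> closed_simplex K s"
      by (auto simp: topspace_realization closed_simplex_def)
    ultimately show ?thesis
      unfolding openin_subtopology by blast
  qed
  then show "openin (realization K) {x \<in> topspace (realization K). x v \<in> U}"
    unfolding openin_realization by (auto simp: topspace_realization)
qed auto

text \<open>Weak openness is a condition on every simplex, but points whose coordinate at one fixed
  vertex is positive have their supports among the finitely many simplices through that vertex.
  Locally, finitely many coordinate-open conditions therefore suffice.\<close>

lemma continuous_map_into_realization: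
  fixes f :: "'a \<Rightarrow> 'v \<Rightarrow> real"
  assumes K: "locally_finite_complex K"
    and f: "\<And>q. q \<in> topspace S \<Longrightarrow> f q \<in> realization_points K"
    and cont: "\<And>v. continuous_map S euclideanreal (\<lambda>q. f q v)"
  shows "continuous_map S (realization K) f"
proof -
  have pt: "continuous_map S (powertop_real UNIV) f"
    using cont by (simp add: continuous_map_componentwise_UNIV)
  have "openin S {q \<in> topspace S. f q \<in> U}" if U: "openin (realization K) U" for U
  proof (subst openin_subopen, intro ballI)
    fix p assume p: "p \<in> {q \<in> topspace S. f q \<in> U}"
    let ?s = "{v. f p v \<noteq> 0}"
    have fp: "f p \<in> realization_points K" and sK: "?s \<in> K"
      using f[of p] p realization_point_support by auto
    obtain v where v: "0 < f p v"
      using realization_point_ex_pos[OF fp] .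
    define \<S> where "\<S> = {s \<in> K. v \<in> s \<and> ?s \<subseteq> s}"
    have "v \<in> \<Union>K"
      using sK v by (auto intro!: bexI[of _ ?s])
    then have fin: "finite {s \<in> K. v \<in> s}"
      using K unfolding locally_finite_complex_def by blast
    then have fin\<S>: "finite \<S>"
      by (rule rev_finite_subset) (auto simp: \<S>_def)
    have "\<exists>O'. openin (powertop_real UNIV) O' \<and> U \<inter> closed_simplex K s = O' \<inter> closed_simplex K s"
      if "s \<in> K" for s
      using U that unfolding openin_realization openin_subtopology by blast
    then obtain O' where O': "\<And>s. s \<in> K \<Longrightarrow> openin (powertop_real UNIV) (O' s)"
       "\<And>s. s \<in> K \<Longrightarrow> U \<inter> closed_simplex K s = O' s \<inter> closed_simplex K s"
      by metis
    \<comment> \<open>The second intersection keeps the coordinates in \<open>?s\<close> positive,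
      so the support of \<open>f q\<close> is a simplex containing \<open>?s\<close> and hence
      belongs to the finite family \<open>\<S>\<close>. The first intersection then tests
      \<open>f q\<close> on that simplex.\<close>
    define N where "N = (\<Inter>s\<in>\<S>. {q \<in> topspace S. f q \<in> O' s}) \<inter>
        (\<Inter>u\<in>?s. {q \<in> topspace S. f q u \<in> {0<..}})"
    have "?s \<in> \<S>"
      using sK v by (simp add: \<S>_def)
    \<comment> \<open>A sum over an infinite set has the default value 0, whereas the coordinates
      sum to 1.\<close>
    have "finite ?s"
      using fp by (intro ccontr[of "finite ?s"]) (simp add: realization_points_def)
    moreover have "\<S> \<noteq> {}" "?s \<noteq> {}"
      using \<open>?s \<in> \<S>\<close> v by force+
    ultimately have "openin S N"
      unfolding N_def using fin\<S>
      by (intro openin_Int openin_INT2 openin_vimage_real[OF cont]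
          openin_continuous_map_preimage[OF pt] O'(1)) (auto simp: \<S>_def)
    moreover have "p \<in> N"
    proof -
      have "f p \<in> O' s" if "s \<in> \<S>" for s
      proof -
        have "f p \<in> U \<inter> closed_simplex K s"
          using that p fp by (auto simp: \<S>_def closed_simplex_def)
        then show ?thesis
          using O'(2)[of s] that by (auto simp: \<S>_def)
      qed
      then show ?thesis
        using p realization_point_pos[OF fp] by (auto simp: N_def)
    qed
    moreover have "N \<subseteq> {q \<in> topspace S. f q \<in> U}"
    proof
      fix q assume q: "q \<in> N"
      then have qS: "q \<in> topspace S"
        using \<open>?s \<noteq> {}\<close> by (auto simp: N_def)
      let ?t = "{v. f q v \<noteq> 0}"
      have sup: "?s \<subseteq> ?t"
        using q by (force simp: N_def)
      have "?t \<in> \<S>"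
        using sup subsetD[OF sup, of v] v realization_point_support[OF f[OF qS]] by (simp add: \<S>_def)
      then have "f q \<in> O' ?t"
        using q by (auto simp: N_def)
      then have "f q \<in> U"
        using O'(2)[of ?t] closed_simplex_self[OF f[OF qS]] \<open>?t \<in> \<S>\<close> by (auto simp: \<S>_def)
      then show "q \<in> {q \<in> topspace S. f q \<in> U}"
        using qS by simp
    qed
    ultimately show "\<exists>T. openin S T \<and> p \<in> T \<and> T \<subseteq> {q \<in> topspace S. f q \<in> U}"
      by blast
  qed
  then show ?thesis
    unfolding continuous_map using f by (auto simp: topspace_realization)
qed

section \<open>The realization inside the bounded functions on the vertices\<close>

lemma realization_point_bcontfun:
  fixes K :: "nat set set"
  assumes "abstract_simplicial_complex K" "x \<in> realization_points K"
  shows "x \<in> bcontfun"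
  using assms realization_point_le_1[OF assms]
  by (intro bcontfun_normI[where b = 1]) (auto simp: realization_points_def continuous_on_discrete)

lemma apply_Bcontfun_realization_point:
  fixes K :: "nat set set"
  assumes "abstract_simplicial_complex K" "x \<in> realization_points K"
  shows "apply_bcontfun (Bcontfun x) = x"
  using Bcontfun_inverse realization_point_bcontfun[OF assms] by blast

lemma norm_Bcontfun_realization_point:
  fixes K :: "nat set set"
  assumes "abstract_simplicial_complex K" "x \<in> realization_points K"
  shows "norm (Bcontfun x) \<le> 1"
  using assms realization_point_le_1[OF assms]
  by (intro norm_bound)
     (auto simp: apply_Bcontfun_realization_point realization_points_def)

text \<open>The norm involves all vertices at once. Near \<open>x\<close> some fixed coordinate
  \<open>v\<close> stays positive, which forces every coordinate outside the finite star of
  \<open>v\<close> to vanish, so finitely many coordinate conditions control the norm.\<close>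

lemma continuous_map_Bcontfun_realization:
  fixes K :: "nat set set"
  assumes K: "abstract_simplicial_complex K" "locally_finite_complex K"
  shows "continuous_map (realization K) euclidean Bcontfun"
  unfolding continuous_map_euclidean_iff_dist topspace_realization
proof (intro ballI allI impI)
  fix x and \<epsilon> :: real
  assume x: "x \<in> realization_points K" and "0 < \<epsilon>"
  obtain v where v: "0 < x v"
    using realization_point_ex_pos[OF x] .
  let ?S = "\<Union>{s \<in> K. v \<in> s}"
  \<comment> \<open>Half of \<open>\<epsilon>\<close>, because passing to the supremum over the
    coordinates yields only a non-strict bound.\<close>
  define U where "U = {y \<in> topspace (realization K). y v \<in> {0<..}} \<inter>
      (\<Inter>u\<in>insert v ?S. {y \<in> topspace (realization K). y u \<in> ball (x u) (\<epsilon>/2)})"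
  have "openin (realization K) U"
    unfolding U_def
    by (intro openin_Int openin_INT2 openin_vimage_real[OF continuous_map_realization_coord])
       (use finite_star_vertices[OF K, of v] in auto)
  moreover have "x \<in> U"
    using x v \<open>0 < \<epsilon>\<close> by (auto simp: U_def topspace_realization)
  moreover have "dist (Bcontfun x) (Bcontfun y) < \<epsilon>" if "y \<in> U" for y
  proof -
    have y: "y \<in> realization_points K" "0 < y v"
      using that by (auto simp: U_def topspace_realization)
    have "dist (x u) (y u) \<le> \<epsilon>/2" for u
    proof (cases "u \<in> ?S")
      case True
      then show ?thesis
        using that by (auto simp: U_def intro: less_imp_le)
    next
      case False
        have "w u = 0" if "w \<in> realization_points K" "0 < w v" for w
      proof (rule ccontr)
        assume "w u \<noteq> 0"
        then have "u \<in> \<Union>{s \<in> K. v \<in> s}"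
          using realization_point_support[OF that(1)] that(2)
          by (intro UnionI[of "{v. w v \<noteq> 0}"]) auto
        with False show False
          by blast
      qed
      then have "x u = 0" "y u = 0"
        using x v y by auto
      then show ?thesis
        using \<open>0 < \<epsilon>\<close> by simp
    qed
    then have "dist (Bcontfun x) (Bcontfun y) \<le> \<epsilon>/2"
      by (intro dist_bound) (simp add: apply_Bcontfun_realization_point[OF K(1)] x y)
    then show ?thesis
      using \<open>0 < \<epsilon>\<close> by simp
  qed
  ultimately show "\<exists>U. openin (realization K) U \<and> x \<in> U \<and>
      (\<forall>y\<in>U. dist (Bcontfun x) (Bcontfun y) < \<epsilon>)"
    by blast
qed

section \<open>Dugundji extension with a parameter\<close>

text \<open>Indices of weight zero are free: only the \<open>g i\<close> that enter the mean have to
  be close to \<open>b\<close>. Continuity of the Dugundji extension at a point of the closed set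
  rests on this, with \<open>b\<close> the value there.\<close>

lemma norm_weighted_mean_diff_le:
  fixes g :: "nat \<Rightarrow> 'e::banach"
  assumes c: "\<And>i. 0 \<le> c i" "summable c" and pos: "0 < (\<Sum>i. c i)"
    and cg: "summable (\<lambda>i. c i *\<^sub>R g i)"
    and close: "\<And>i. c i \<noteq> 0 \<Longrightarrow> norm (g i - b) \<le> \<epsilon>"
  shows "norm ((\<Sum>i. c i *\<^sub>R g i) /\<^sub>R (\<Sum>i. c i) - b) \<le> \<epsilon>"
proof -
  let ?C = "\<Sum>i. c i"
  have le: "norm (c i *\<^sub>R (g i - b)) \<le> c i * \<epsilon>" for i
    using close[of i] c(1)[of i] by (cases "c i = 0") (auto intro: mult_left_mono)
  have scb: "summable (\<lambda>i. c i *\<^sub>R b)"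
    using summable_scaleR_left[OF c(2)] .
  have "(\<Sum>i. c i *\<^sub>R g i) - ?C *\<^sub>R b = (\<Sum>i. c i *\<^sub>R (g i - b))"
    using suminf_diff[OF cg scb] suminf_scaleR_left[OF c(2), of b] by (simp add: scaleR_diff_right)
  moreover have "norm (\<Sum>i. c i *\<^sub>R (g i - b)) \<le> (\<Sum>i. c i * \<epsilon>)"
    using le summable_mult2[OF c(2)] by (rule norm_suminf_le)
  ultimately have "norm ((\<Sum>i. c i *\<^sub>R g i) - ?C *\<^sub>R b) \<le> ?C * \<epsilon>"
    using suminf_mult2[OF c(2), of \<epsilon>] by simp
  moreover have "(\<Sum>i. c i *\<^sub>R g i) /\<^sub>R ?C - b = ((\<Sum>i. c i *\<^sub>R g i) - ?C *\<^sub>R b) /\<^sub>R ?C"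
    using pos by (simp add: scaleR_diff_right)
  ultimately show ?thesis
    using pos by (simp add: pos_divide_le_eq mult.commute divide_inverse_commute[symmetric])
qed

lemma continuous_map_scaleR:
  fixes f :: "'a \<Rightarrow> 'e::real_normed_vector"
  assumes "continuous_map X euclideanreal a" "continuous_map X euclidean f"
  shows "continuous_map X euclidean (\<lambda>x. a x *\<^sub>R f x)"
  using assms by (simp add: continuous_map_atin tendsto_scaleR)

lemma continuous_map_suminf:
  fixes f :: "nat \<Rightarrow> 'a \<Rightarrow> 'e::banach"
  assumes "\<And>i. continuous_map X euclidean (f i)"
    and "\<And>i x. x \<in> topspace X \<Longrightarrow> norm (f i x) \<le> B i" and "summable B"
  shows "continuous_map X euclidean (\<lambda>x. \<Sum>i. f i x)"
proof -
  have "uniform_limit (topspace X) (\<lambda>n x. \<Sum>i<n. f i x) (\<lambda>x. \<Sum>i. f i x) sequentially"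
    using assms(2,3) by (intro Weierstrass_m_test) auto
  then have "\<forall>\<^sub>F n in sequentially. \<forall>x\<in>topspace X. (\<Sum>i. f i x) \<in> UNIV \<and>
       dist (\<Sum>i<n. f i x) (\<Sum>i. f i x) < \<epsilon>" if "0 < \<epsilon>" for \<epsilon>
    using uniform_limitD[OF _ that] by auto
  then show ?thesis
    using assms(1)
    by (intro Met_TC.continuous_map_uniform_limit[of X "\<lambda>n x. \<Sum>i<n. f i x" sequentially,
          unfolded mtopology_is_euclidean])
       (auto intro!: continuous_map_sum always_eventually)
qed

text \<open>Exchanging \<open>x\<close> and \<open>z\<close> turns the one-sided bound into a
  Lipschitz condition with constant 1.\<close>

lemma (in Metric_space) continuous_map_of_le_add_dist:
  assumes h: "\<And>x z. x \<in> M \<Longrightarrow> z \<in> M \<Longrightarrow> h x \<le> d x z + h z"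
  shows "continuous_map mtopology euclideanreal h"
  unfolding continuous_map_euclidean_iff_dist
proof (intro ballI allI impI)
  fix x and \<epsilon> :: real assume x: "x \<in> topspace mtopology" and "0 < \<epsilon>"
  have "dist (h x) (h z) < \<epsilon>" if "z \<in> mball x \<epsilon>" for z
    using h[of x z] h[of z x] that x commute[of x z] by (simp add: dist_real_def abs_less_iff)
  then show "\<exists>U. openin mtopology U \<and> x \<in> U \<and> (\<forall>y\<in>U. dist (h x) (h y) < \<epsilon>)"
    using x \<open>0 < \<epsilon>\<close> by (intro exI[of _ "mball x \<epsilon>"]) auto
qed

text \<open>For separable spaces the Whitney partition of unity in Dugundji's theorem can be replaced by a
  weighted mean over a sequence \<^term>\<open>y\<close> dense in \<^term>\<open>Y\<close>, in which only the points closer to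
  \<^term>\<open>z\<close> than twice the distance from \<^term>\<open>z\<close> to \<^term>\<open>Y\<close> count. The weights do not involve
  the parameter in \<^term>\<open>T\<close>.\<close>

theorem Dugundji_parametrized:
  fixes f :: "'t \<times> 'z \<Rightarrow> 'e::banach"
  assumes Z: "metrizable_space Z" "second_countable Z" and Y: "closedin Z Y"
    and f: "continuous_map (prod_topology T (subtopology Z Y)) euclidean f"
    and bound: "\<And>t z. t \<in> topspace T \<Longrightarrow> z \<in> Y \<Longrightarrow> norm (f (t, z)) \<le> B"
  obtains F where "continuous_map (prod_topology T Z) euclidean F"
    and "\<And>t z. t \<in> topspace T \<Longrightarrow> z \<in> Y \<Longrightarrow> F (t, z) = f (t, z)"
proof (cases "Y = {}")
  case True
  then show ?thesis
    using that[of "\<lambda>_. 0"] by simp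
next
  case False
  obtain M d where "Metric_space M d" and Zd: "Z = Metric_space.mtopology M d"
    using Z(1) unfolding metrizable_space_def by blast
  interpret Metric_space M d
    by fact
  have YM: "Y \<subseteq> M"
    using closedin_subset[OF Y] Zd by simp
  have openV: "openin Z (M - Y)"
    using openin_diff[OF openin_topspace Y] Zd by simp
  have "separable_space (subtopology Z Y)"
    using Z(2) by (intro second_countable_imp_separable_space second_countable_subtopology)
  then obtain D where D: "countable D" "D \<subseteq> Y" "subtopology Z Y closure_of D = Y"
    using YM Zd by (auto simp: separable_space_def Int_absorb1)
  with False have "D \<noteq> {}"
    by auto
  then obtain y :: "nat \<Rightarrow> 'z" where y: "range y = D"
    using D(1) range_from_nat_into[of D] by blast
  have yY: "y i \<in> Y" for i
    using y D(2) by auto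
  then have yM: "y i \<in> M" for i
    using YM by auto
  have dense: "\<exists>i. d a (y i) < \<epsilon>" if a: "a \<in> Y" and e: "0 < \<epsilon>" for a \<epsilon>
  proof -
    have "a \<in> Z closure_of D"
      using a D(3) closure_of_subtopology_subset[of Z Y D] by blast
    then obtain b where "b \<in> D" "b \<in> mball a \<epsilon>"
      using e Zd by (auto simp: metric_closure_of)
    then show ?thesis
      using y by auto
  qed
  \<comment> \<open>By density this is the distance to \<open>Y\<close>. With the infimum over the
    sequence itself, some \<open>y i\<close> lies within any radius larger than
    \<open>\<delta> z\<close>.\<close>
  define \<delta> where "\<delta> z = (INF i. d z (y i))" for z
  have bdd: "bdd_below (range (\<lambda>i. d z (y i)))" for z
    by (rule bdd_belowI2[of _ 0]) simp
  have \<delta>_le: "\<delta> z \<le> d z (y i)" for z i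
    unfolding \<delta>_def using bdd by (rule cINF_lower) simp
  have \<delta>_less: "\<exists>i. d z (y i) < r" if "\<delta> z < r" for z r
    using that bdd unfolding \<delta>_def by (subst (asm) cINF_less_iff) auto
  have \<delta>_tri: "\<delta> z \<le> d z z' + \<delta> z'" if "z \<in> M" "z' \<in> M" for z z'
  proof -
    have "\<delta> z - d z z' \<le> d z' (y i)" for i
      using \<delta>_le[of z i] triangle[OF that(1,2) yM[of i]] by linarith
    then have "\<delta> z - d z z' \<le> \<delta> z'"
      unfolding \<delta>_def[of z'] by (intro cINF_greatest) auto
    then show ?thesis
      by linarith
  qed
  have \<delta>_le_Y: "\<delta> z \<le> d z a" if z: "z \<in> M" and a: "a \<in> Y" for z a
  proof (rule field_le_epsilon)
    fix e :: real assume "0 < e"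
    then obtain i where "d a (y i) < e"
      using dense[OF a] by blast
    then show "\<delta> z \<le> d z a + e"
      using \<delta>_le[of z i] triangle[of z a "y i"] z subsetD[OF YM a] yM[of i] by linarith
  qed
  have \<delta>_pos: "0 < \<delta> z" if z: "z \<in> M - Y" for z
  proof -
    obtain r where "r > 0" "mball z r \<subseteq> M - Y"
      using z openV Zd by (auto simp: openin_mtopology)
    then have "r \<le> d z (y i)" for i
      using yY[of i] yM[of i] z by (force simp: in_mball)
    then have "r \<le> \<delta> z"
      unfolding \<delta>_def by (intro cINF_greatest) auto
    then show ?thesis
      using \<open>r > 0\<close> by linarith
  qed
  define V where "V = subtopology Z (M - Y)"
  have topV: "topspace V = M - Y"
    using Zd by (auto simp: V_def)
  have cont_d: "continuous_map V euclideanreal (\<lambda>z. d z a)" if "a \<in> M" for a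
    unfolding V_def Zd using triangle that
    by (intro continuous_map_from_subtopology continuous_map_of_le_add_dist) auto
  have cont_\<delta>: "continuous_map V euclideanreal \<delta>"
    unfolding V_def Zd
    by (intro continuous_map_from_subtopology continuous_map_of_le_add_dist \<delta>_tri)
  \<comment> \<open>Off \<open>Y\<close>, the weight is nonzero exactly when
    \<open>d z (y i) < 2 * \<delta> z\<close>; some index qualifies since \<open>\<delta> z\<close>
    is a positive infimum. The geometric factor takes over the role of local finiteness in a
    partition of unity: it makes the sums converge uniformly.\<close>
  define c where "c i z = (1/2)^i * max 0 (2 - d z (y i) / \<delta> z)" for i :: nat and z
  have c_nn: "0 \<le> c i z" for i z
    by (simp add: c_def)
  have c_le: "c i z \<le> 2 * (1/2)^i" if "z \<in> M - Y" for i z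
    using \<delta>_pos[OF that] by (simp add: c_def field_simps)
  have sum2: "summable (\<lambda>i. 2 * (1/2)^i :: real)"
    by (intro summable_mult summable_geometric) simp
  have summ_c: "summable (\<lambda>i. c i z)" if "z \<in> M - Y" for z
    using c_nn c_le[OF that] by (intro summable_comparison_test'[OF sum2]) auto
  have c_pos: "0 < (\<Sum>i. c i z)" if z: "z \<in> M - Y" for z
  proof -
    obtain i where "d z (y i) < 2 * \<delta> z"
      using \<delta>_less[of z "2 * \<delta> z"] \<delta>_pos[OF z] by auto
    then have "0 < c i z"
      using \<delta>_pos[OF z] by (simp add: c_def field_simps)
    then show ?thesis
      using summ_c[OF z] c_nn by (intro suminf_pos2) auto
  qed
  have cont_c: "continuous_map V euclideanreal (c i)" for i
    unfolding c_def
    by (intro continuous_map_real_mult continuous_map_real_max continuous_map_diff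
        continuous_map_real_divide cont_d cont_\<delta> yM) (use \<delta>_pos topV in force)+
  \<comment> \<open>The majorant depends on neither \<open>t\<close> nor \<open>z\<close>; this is
    the purpose of the uniform bound \<open>B\<close>.\<close>
  have norm_cf: "norm (c i z *\<^sub>R f (t, y i)) \<le> 2 * (1/2)^i * B"
    if "z \<in> M - Y" "t \<in> topspace T" for i z t
    using mult_mono[OF c_le[OF that(1), of i] bound[OF that(2) yY[of i]]] c_nn[of i z] by simp
  have summ_cf: "summable (\<lambda>i. c i z *\<^sub>R f (t, y i))"
    if "z \<in> M - Y" "t \<in> topspace T" for z t
    using norm_cf[OF that] by (intro summable_comparison_test'[OF summable_mult2[OF sum2]]) auto
  define F where "F = (\<lambda>(t, z). if z \<in> Y then f (t, z)
      else (\<Sum>i. c i z *\<^sub>R f (t, y i)) /\<^sub>R (\<Sum>i. c i z))"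
  have cont_off: "continuous_map (prod_topology T V) euclidean F"
  proof -
    have 1: "continuous_map (prod_topology T V) euclidean (\<lambda>p. \<Sum>i. c i (snd p) *\<^sub>R f (fst p, y i))"
    proof (rule continuous_map_suminf)
      fix i
      have "continuous_map (prod_topology T V) euclideanreal (c i \<circ> snd)"
        by (intro continuous_map_compose[OF _ cont_c] continuous_map_snd)
      moreover have "continuous_map (prod_topology T V) euclidean (f \<circ> (\<lambda>p. (fst p, y i)))"
        using yY yM Zd
        by (intro continuous_map_compose[OF _ f] continuous_map_pairedI continuous_map_fst) auto
      ultimately show "continuous_map (prod_topology T V) euclidean
          (\<lambda>p. c i (snd p) *\<^sub>R f (fst p, y i))"
        using continuous_map_scaleR[of _ "c i \<circ> snd"] by (simp add: o_def)
    next
      fix i p assume "p \<in> topspace (prod_topology T V)"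
      then show "norm (c i (snd p) *\<^sub>R f (fst p, y i)) \<le> 2 * (1/2)^i * B"
        using norm_cf topV by (cases p) auto
    next
      show "summable (\<lambda>i. 2 * (1/2)^i * B)"
        using summable_mult2[OF sum2] .
    qed
    have 2: "continuous_map (prod_topology T V) euclideanreal (\<lambda>p. \<Sum>i. c i (snd p))"
      using continuous_map_compose[OF continuous_map_snd cont_c, of T] c_nn c_le topV
      by (intro continuous_map_suminf[OF _ _ sum2]) (auto simp: o_def)
    have "continuous_map (prod_topology T V) euclideanreal (\<lambda>p. inverse (\<Sum>i. c i (snd p)))"
      using 2 c_pos topV by (intro continuous_map_real_inverse) fastforce+
    with 1 have "continuous_map (prod_topology T V) euclidean
        (\<lambda>p. (\<Sum>i. c i (snd p) *\<^sub>R f (fst p, y i)) /\<^sub>R (\<Sum>i. c i (snd p)))"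
      by (intro continuous_map_scaleR)
    then show ?thesis
      by (rule continuous_map_eq) (auto simp: F_def topV)
  qed
  have "continuous_map (prod_topology T Z) euclidean F"
    unfolding continuous_map_euclidean_iff_dist
  proof (intro ballI allI impI)
    fix p and \<epsilon> :: real
    assume p: "p \<in> topspace (prod_topology T Z)" and "0 < \<epsilon>"
    obtain t\<^sub>0 a where pta: "p = (t\<^sub>0, a)" "t\<^sub>0 \<in> topspace T" "a \<in> M"
      using p Zd by auto
    show "\<exists>U. openin (prod_topology T Z) U \<and> p \<in> U \<and> (\<forall>q\<in>U. dist (F p) (F q) < \<epsilon>)"
    proof (cases "a \<in> Y")
      case False
      then have "p \<in> topspace (prod_topology T V)"
        using pta topV by simp
      then obtain U where "openin (prod_topology T V) U" "p \<in> U" "\<forall>q\<in>U. dist (F p) (F q) < \<epsilon>"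
        using cont_off \<open>0 < \<epsilon>\<close> unfolding continuous_map_euclidean_iff_dist by blast
      moreover have "openin (prod_topology T Z) U" if "openin (prod_topology T V) U"
      proof -
        have "prod_topology T V = subtopology (prod_topology T Z) (topspace T \<times> (M - Y))"
          by (simp add: V_def subtopology_Times)
        moreover have "openin (prod_topology T Z) (topspace T \<times> (M - Y))"
          using openV by (simp add: openin_prod_Times_iff)
        ultimately show ?thesis
          using that openin_open_subtopology by fastforce
      qed
      ultimately show ?thesis
        by blast
    next
      case True
      then have "(t\<^sub>0, a) \<in> topspace (prod_topology T (subtopology Z Y))"
        using pta Zd by simp
      then obtain U where U: "openin (prod_topology T (subtopology Z Y)) U" "(t\<^sub>0, a) \<in> U"
          "\<forall>q\<in>U. dist (f (t\<^sub>0, a)) (f q) < \<epsilon>/2"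
        using f[unfolded continuous_map_euclidean_iff_dist, rule_format, of "(t\<^sub>0, a)" "\<epsilon>/2"]
          \<open>0 < \<epsilon>\<close> by auto
      obtain U1 U2 where U1: "openin T U1" "t\<^sub>0 \<in> U1"
        and U2: "openin (subtopology Z Y) U2" "a \<in> U2" and U12: "U1 \<times> U2 \<subseteq> U"
        using openin_prod_topology_alt[THEN iffD1, rule_format, OF U(1,2)] by blast
      obtain r where r: "r > 0" "mball a r \<inter> Y \<subseteq> U2"
      proof -
        obtain W where W: "openin Z W" "U2 = W \<inter> Y"
          using U2(1) by (auto simp: openin_subtopology)
        then obtain r where "r > 0" "mball a r \<subseteq> W"
          using U2(2) Zd by (metis IntE openin_mtopology)
        then show ?thesis
          using that W by blast
      qed
      have near: "norm (f (t, b) - f (t\<^sub>0, a)) \<le> \<epsilon>/2" if "t \<in> U1" "b \<in> Y" "d a b < r" for t b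
      proof -
        have "b \<in> mball a r \<inter> Y"
          using that YM pta by auto
        then have "(t, b) \<in> U"
          using that(1) r(2) U12 by blast
        then show ?thesis
          using U(3) by (metis dist_commute dist_norm less_imp_le)
      qed
      have U1T: "U1 \<subseteq> topspace T"
        using U1(1) openin_subset by blast
      \<comment> \<open>The radius \<open>r/3\<close>: if \<open>y i\<close> has nonzero weight at
        \<open>z\<close>, then \<open>d z (y i) < 2 * \<delta> z\<close>, which is at most
        \<open>2 * d z a\<close>, so \<open>d a (y i)\<close> is less than three times
        \<open>d a z\<close>, hence less than \<open>r\<close>.\<close>
      have "dist (F p) (F q) < \<epsilon>" if q: "q \<in> U1 \<times> mball a (r/3)" for q
      proof -
        obtain t z where qtz: "q = (t, z)" and t: "t \<in> U1" and z: "z \<in> M" "d a z < r/3"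
          using q by (auto simp: in_mball)
        have "norm (F (t, z) - f (t\<^sub>0, a)) \<le> \<epsilon>/2"
        proof (cases "z \<in> Y")
          case True
          then show ?thesis
            using near[OF t True] z r(1) by (simp add: F_def)
        next
          case False
          then have zM: "z \<in> M - Y"
            using z by simp
          have close: "norm (f (t, y i) - f (t\<^sub>0, a)) \<le> \<epsilon>/2" if "c i z \<noteq> 0" for i
          proof (rule near[OF t yY])
            have "d z (y i) < 2 * \<delta> z"
              using that \<delta>_pos[OF zM] by (auto simp: c_def max_def field_simps split: if_splits)
            also have "\<delta> z \<le> d z a"
              using \<delta>_le_Y[OF z(1) True] .
            finally show "d a (y i) < r"
              using triangle[of a z "y i"] z pta yM[of i] commute[of z a] by auto
          qed
          have "t \<in> topspace T"
            using t U1T by blast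
          then show ?thesis
            using norm_weighted_mean_diff_le[OF c_nn summ_c[OF zM] c_pos[OF zM] summ_cf[OF zM] close]
              False by (simp add: F_def)
        qed
        then show ?thesis
          using \<open>0 < \<epsilon>\<close> True pta qtz by (simp add: F_def dist_norm norm_minus_commute)
      qed
      moreover have "openin (prod_topology T Z) (U1 \<times> mball a (r/3))"
        using U1 Zd by (simp add: openin_prod_Times_iff)
      moreover have "p \<in> U1 \<times> mball a (r/3)"
        using U1 r pta by simp
      ultimately show ?thesis
        by blast
    qed
  qed
  then show ?thesis
    using that[of F] by (simp add: F_def)
qed

section \<open>Retraction of a neighbourhood onto the realization\<close>

text \<open>Writing \<^term>\<open>x\<close> as the integral over \<^term>\<open>r > 0\<close> of the indicators of
  \<^term>\<open>{v. r < x v}\<close>, the retraction keeps the levels at which this set is a simplex; this is the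
  usual retraction onto the full subcomplex \<^term>\<open>K\<close> after barycentric subdivision. Those levels lie
  above the cutoff, since \<^term>\<open>{v. r < x v}\<close> contains a non-simplex \<^term>\<open>F\<close> iff
  \<^term>\<open>r < Min (x ` F)\<close>.\<close>

definition cutoff :: "'v set set \<Rightarrow> ('v \<Rightarrow> real) \<Rightarrow> real" where
  "cutoff K x = Sup (insert 0 {Min (x ` F) | F. finite F \<and> F \<noteq> {} \<and> F \<notin> K})"

text \<open>The retraction is defined where this is positive. As a difference of two Lipschitz
  functions it is continuous on the whole Banach space, so it can also measure whether a path stays
  in that domain.\<close>

definition gap :: "'v set set \<Rightarrow> ('v \<Rightarrow> real) \<Rightarrow> real" where
  "gap K x = (SUP v. x v) - cutoff K x"

text \<open>The numerator is the total length of the levels above the cutoff at which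
  \<open>v\<close> belongs to the superlevel set; the division makes these lengths barycentric
  coordinates.\<close>

definition simplicial_retraction :: "'v set set \<Rightarrow> ('v \<Rightarrow> real) \<Rightarrow> 'v \<Rightarrow> real" where
  "simplicial_retraction K x v =
     max 0 (x v - cutoff K x) / (\<Sum>u | cutoff K x < x u. x u - cutoff K x)"

lemma bcontfun_le_add_dist:
  fixes x y :: "'v::topological_space \<Rightarrow>\<^sub>C real"
  shows "x v \<le> y v + dist x y"
  using dist_bounded[of x v y] by (simp add: dist_real_def)

lemma bdd_above_range_bcontfun: "bdd_above (range (apply_bcontfun x))"
  for x :: "'v::topological_space \<Rightarrow>\<^sub>C real"
  by (simp add: bounded_imp_bdd_above)

lemma bdd_above_cutoff:
  fixes x :: "'v::topological_space \<Rightarrow>\<^sub>C real"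
  shows "bdd_above (insert 0 {Min (x ` F) | F. finite F \<and> F \<noteq> {} \<and> F \<notin> K})"
proof -
  have "Min (x ` F) \<le> norm x" if F: "finite F" "F \<noteq> {}" for F
  proof -
    obtain v where "v \<in> F"
      using F(2) by blast
    then have "Min (x ` F) \<le> x v"
      using F(1) by simp
    then show ?thesis
      using norm_bounded[of x v] by simp
  qed
  then show ?thesis
    by (auto intro!: bdd_aboveI[of _ "norm x"])
qed

lemma cutoff_nonneg: "0 \<le> cutoff K (apply_bcontfun x)"
  unfolding cutoff_def by (intro cSup_upper bdd_above_cutoff) simp

lemma Min_le_cutoff:
  assumes "finite F" "F \<noteq> {}" "F \<notin> K"
  shows "Min (apply_bcontfun x ` F) \<le> cutoff K (apply_bcontfun x)"
  unfolding cutoff_def using assms by (intro cSup_upper bdd_above_cutoff) auto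

text \<open>For fixed \<open>F\<close> the minimum over \<open>F\<close> changes by at most the sup
  distance, and such a bound survives a supremum over all \<open>F\<close>.\<close>

lemma cutoff_le_add_dist:
  fixes x y :: "'v::topological_space \<Rightarrow>\<^sub>C real"
  shows "cutoff K x \<le> cutoff K y + dist x y"
  unfolding cutoff_def[of K "apply_bcontfun x"]
proof (rule cSup_least)
  fix a assume a: "a \<in> insert 0 {Min (x ` F) | F. finite F \<and> F \<noteq> {} \<and> F \<notin> K}"
  show "a \<le> cutoff K y + dist x y"
  proof (cases "a = 0")
    case True
    then show ?thesis
      using cutoff_nonneg[of K y] by (simp add: add_nonneg_nonneg)
  next
    case False
    then obtain F where F: "a = Min (x ` F)" "finite F" "F \<noteq> {}" "F \<notin> K"
      using a by auto
    have "Min (y ` F) \<in> y ` F"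
      using F by (intro Min_in) auto
    then obtain v where v: "v \<in> F" "Min (y ` F) = y v"
      by blast
    have "a \<le> x v"
      using F v by simp
    then show ?thesis
      using bcontfun_le_add_dist[of x v y] Min_le_cutoff[OF F(2-4), of y] v by linarith
  qed
qed simp

lemma SUP_bcontfun_le_add_dist:
  fixes x y :: "'v::topological_space \<Rightarrow>\<^sub>C real"
  shows "(SUP v. x v) \<le> (SUP v. y v) + dist x y"
proof (rule cSUP_least)
  fix v
  have "y v \<le> (SUP v. y v)"
    by (intro cSUP_upper bdd_above_range_bcontfun) simp
  then show "x v \<le> (SUP v. y v) + dist x y"
    using bcontfun_le_add_dist[of x v y] by linarith
qed simp

lemma continuous_on_of_le_add_dist:
  fixes f :: "'a::metric_space \<Rightarrow> real"
  assumes "\<And>x y. f x \<le> f y + dist x y"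
  shows "continuous_on S f"
proof (rule continuous_on_subset[OF _ subset_UNIV], unfold continuous_on_iff, intro ballI allI impI)
  fix x :: 'a and e :: real assume "0 < e"
  moreover have "dist (f y) (f x) \<le> dist y x" for y
    using assms[of x y] assms[of y x] by (simp add: dist_real_def abs_le_iff dist_commute)
  ultimately show "\<exists>d>0. \<forall>y\<in>UNIV. dist y x < d \<longrightarrow> dist (f y) (f x) < e"
    using le_less_trans by blast
qed

lemma continuous_on_cutoff: "continuous_on S (\<lambda>x. cutoff K (apply_bcontfun x))"
  by (intro continuous_on_of_le_add_dist cutoff_le_add_dist)

lemma continuous_on_apply_bcontfun_real: "continuous_on S (\<lambda>x. apply_bcontfun x v :: real)"
  by (intro continuous_on_of_le_add_dist bcontfun_le_add_dist)

lemma continuous_on_gap: "continuous_on S (\<lambda>x. gap K (apply_bcontfun x))"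
  unfolding gap_def
  by (intro continuous_on_diff continuous_on_cutoff continuous_on_of_le_add_dist
      SUP_bcontfun_le_add_dist)

lemma gap_pos_iff: "0 < gap K (apply_bcontfun x) \<longleftrightarrow> (\<exists>v. cutoff K (apply_bcontfun x) < apply_bcontfun x v)"
  using less_cSUP_iff[OF _ bdd_above_range_bcontfun[of x], of "cutoff K (apply_bcontfun x)"]
  by (simp add: gap_def)

text \<open>Two vertices above the cutoff span a simplex, for otherwise the smaller of their two
  values would count towards the cutoff. The case \<open>u = v\<close> shows that \<open>v\<close>
  is a vertex of \<open>K\<close>.\<close>

lemma superlevel_subset_star:
  assumes v: "cutoff K (apply_bcontfun x) < apply_bcontfun x v"
  shows "{u. cutoff K (apply_bcontfun x) < apply_bcontfun x u} \<subseteq> \<Union>{s \<in> K. v \<in> s}"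
proof
  fix u assume u: "u \<in> {u. cutoff K (apply_bcontfun x) < apply_bcontfun x u}"
  have "Min (apply_bcontfun x ` {u, v}) \<in> apply_bcontfun x ` {u, v}"
    by (intro Min_in) auto
  then have "cutoff K (apply_bcontfun x) < Min (apply_bcontfun x ` {u, v})"
    using u v by auto
  then have "{u, v} \<in> K"
    using Min_le_cutoff[of "{u, v}" K x] by force
  then show "u \<in> \<Union>{s \<in> K. v \<in> s}"
    by blast
qed

text \<open>Finiteness comes first, from the star of one vertex, because the cutoff tests only
  finite sets. The minimum over the superlevel set is then attained and exceeds the cutoff, so the
  set cannot be a non-simplex.\<close>

lemma superlevel_simplex:
  fixes x :: "'v::topological_space \<Rightarrow>\<^sub>C real"
  assumes K: "abstract_simplicial_complex K" "locally_finite_complex K" and x: "0 < gap K x"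
  shows "finite {u. cutoff K x < x u}" "{u. cutoff K x < x u} \<in> K"
proof -
  obtain v where v: "cutoff K x < x v"
    using x gap_pos_iff by blast
  show fin: "finite {u. cutoff K x < x u}"
    using superlevel_subset_star[OF v] finite_star_vertices[OF K] finite_subset by blast
  let ?F = "{u. cutoff K x < x u}"
  have "Min (x ` ?F) \<in> x ` ?F"
    using fin v by (intro Min_in) auto
  then have "cutoff K x < Min (x ` ?F)"
    by auto
  then show "?F \<in> K"
    using Min_le_cutoff[OF fin, of K x] v by force
qed

lemma simplicial_retraction_in_realization:
  fixes x :: "'v::topological_space \<Rightarrow>\<^sub>C real"
  assumes K: "abstract_simplicial_complex K" "locally_finite_complex K" and x: "0 < gap K x"
  shows "simplicial_retraction K x \<in> realization_points K"
proof -
  let ?F = "{u. cutoff K x < x u}" and ?r = "simplicial_retraction K x"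
  define s where "s = (\<Sum>u\<in>?F. x u - cutoff K x)"
  have fin: "finite ?F"
    using superlevel_simplex[OF K x] by blast
  moreover have "?F \<noteq> {}"
    using x gap_pos_iff by blast
  ultimately have s: "0 < s"
    unfolding s_def by (intro sum_pos) auto
  have r: "?r v = max 0 (x v - cutoff K x) / s" for v
    by (simp add: simplicial_retraction_def s_def)
  then have supp: "{v. ?r v \<noteq> 0} = ?F"
    using s by (auto simp: max_def)
  have "(\<Sum>v\<in>?F. ?r v) = (\<Sum>v\<in>?F. (x v - cutoff K x) / s)"
    by (intro sum.cong) (auto simp: r)
  also have "\<dots> = 1"
    using s by (simp add: s_def flip: sum_divide_distrib)
  finally show ?thesis
    using superlevel_simplex(2)[OF K x] s unfolding realization_points_def
    by (simp add: supp) (simp add: r)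
qed

text \<open>The index set of the normalizing sum varies with \<open>x\<close>. On the open set where
  \<open>w\<close> lies above the cutoff it stays inside the finite star of \<open>w\<close>, and
  positive parts allow summing over that fixed star. These open sets cover the domain.\<close>

lemma continuous_on_simplicial_retraction:
  fixes K :: "'v::topological_space set set"
  assumes K: "abstract_simplicial_complex K" "locally_finite_complex K"
  shows "continuous_on {x :: 'v \<Rightarrow>\<^sub>C real. 0 < gap K x} (\<lambda>x. simplicial_retraction K x v)"
proof -
  let ?N = "\<lambda>w. {x :: 'v \<Rightarrow>\<^sub>C real. cutoff K x < x w}"
  have N: "open (?N w)" for w
    by (intro open_Collect_less continuous_on_cutoff continuous_on_apply_bcontfun_real)
  have "continuous_on (?N w) (\<lambda>x. simplicial_retraction K x v)" for w
  proof -
    let ?S = "\<Union>{s \<in> K. w \<in> s}"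
    have fin: "finite ?S"
      using finite_star_vertices[OF K] .
    have eq: "(\<Sum>u | cutoff K x < x u. x u - cutoff K x) = (\<Sum>u\<in>?S. max 0 (x u - cutoff K x))"
      if "x \<in> ?N w" for x :: "'v \<Rightarrow>\<^sub>C real"
      using superlevel_subset_star[of K x w] that fin
      by (intro sum.mono_neutral_cong_left) (auto simp: max_def)
    have pos: "(\<Sum>u\<in>?S. max 0 (x u - cutoff K x)) \<noteq> 0" if "x \<in> ?N w" for x :: "'v \<Rightarrow>\<^sub>C real"
    proof -
      have "w \<in> ?S"
        using superlevel_subset_star[of K x w] that by blast
      then have "0 < (\<Sum>u\<in>?S. max 0 (x u - cutoff K x))"
        using that fin by (intro sum_pos2[of _ w]) auto
      then show ?thesis
        by simp
    qed
    have "continuous_on (?N w)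
        (\<lambda>x. max 0 (x v - cutoff K x) / (\<Sum>u\<in>?S. max 0 (x u - cutoff K x)))"
      using pos by (intro continuous_intros continuous_on_cutoff continuous_on_apply_bcontfun_real) auto
    then show ?thesis
      using eq by (subst continuous_on_cong[OF refl]) (auto simp: simplicial_retraction_def)
  qed
  then have "continuous_on (\<Union>w. ?N w) (\<lambda>x. simplicial_retraction K x v)"
    using N by (intro continuous_on_open_UN) auto
  moreover have "(\<Union>w. ?N w) = {x. 0 < gap K (apply_bcontfun x)}"
    by (auto simp: gap_pos_iff)
  ultimately show ?thesis
    by simp
qed

lemma continuous_map_simplicial_retraction:
  fixes \<Phi> :: "'a \<Rightarrow> 'v::topological_space \<Rightarrow>\<^sub>C real"
  assumes K: "abstract_simplicial_complex K" "locally_finite_complex K"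
    and \<Phi>: "continuous_map S euclidean \<Phi>" and gap: "\<And>q. q \<in> topspace S \<Longrightarrow> 0 < gap K (\<Phi> q)"
  shows "continuous_map S (realization K) (\<lambda>q. simplicial_retraction K (\<Phi> q))"
proof (rule continuous_map_into_realization[OF K(2)])
  show "simplicial_retraction K (\<Phi> q) \<in> realization_points K" if "q \<in> topspace S" for q
    using simplicial_retraction_in_realization[OF K gap[OF that]] .
  fix v
  have "continuous_map S (top_of_set {x. 0 < gap K (apply_bcontfun x)}) \<Phi>"
    using \<Phi> gap by (simp add: continuous_map_in_subtopology image_subset_iff)
  moreover have "continuous_map (top_of_set {x. 0 < gap K (apply_bcontfun x)}) euclideanreal
       (\<lambda>x. simplicial_retraction K (apply_bcontfun x) v)"
    using continuous_on_simplicial_retraction[OF K] by simp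
  ultimately show "continuous_map S euclideanreal (\<lambda>q. simplicial_retraction K (\<Phi> q) v)"
    using continuous_map_compose[of S _ \<Phi> euclideanreal
        "\<lambda>x. simplicial_retraction K (apply_bcontfun x) v"] by (simp add: o_def)
qed

text \<open>A non-simplex is never contained in the support of \<open>x\<close>, so it has a vertex
  where \<open>x\<close> vanishes. Hence the cutoff is 0, and the retraction formula reduces to the
  identity.\<close>

lemma
  fixes K :: "nat set set"
  assumes K: "abstract_simplicial_complex K" and x: "x \<in> realization_points K"
  shows gap_realization_point: "0 < gap K (Bcontfun x)"
    and simplicial_retraction_realization_point: "simplicial_retraction K (Bcontfun x) = x"
proof -
  have B: "apply_bcontfun (Bcontfun x) = x"
    using apply_Bcontfun_realization_point[OF K x] .
  have nn: "0 \<le> x v" for v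
    using x by (simp add: realization_points_def)
  have "Min (x ` F) \<le> 0" if F: "finite F" "F \<noteq> {}" "F \<notin> K" for F
  proof -
    have "\<not> F \<subseteq> {v. x v \<noteq> 0}"
      using F K realization_point_support[OF x] unfolding abstract_simplicial_complex_def by blast
    then obtain u where "u \<in> F" "x u = 0"
      by blast
    then show ?thesis
      using F(1) by (metis Min_le finite_imageI imageI)
  qed
  then have "cutoff K x \<le> 0"
    unfolding cutoff_def by (intro cSup_least) auto
  then have c: "cutoff K x = 0"
    using cutoff_nonneg[of K "Bcontfun x"] B by simp
  then show "0 < gap K (Bcontfun x)"
    using realization_point_ex_pos[OF x] gap_pos_iff[of K "Bcontfun x"] B by auto
  have "{u. 0 < x u} = {u. x u \<noteq> 0}"
    using nn by (auto simp: order_less_le)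
  then have "(\<Sum>u | 0 < x u. x u) = 1"
    using x by (simp add: realization_points_def)
  then show "simplicial_retraction K (Bcontfun x) = x"
    using nn by (auto simp: simplicial_retraction_def B c)
qed

section \<open>Minima over a compact factor, second countability and zero sets\<close>

text \<open>Sublevel sets of the minimum are projections of sublevel sets of \<open>f\<close>.
  Projections are open maps, and they are closed along a compact factor, which gives both
  semicontinuities without a metric.\<close>

lemma
  assumes f: "continuous_map (prod_topology X Y) euclideanreal f"
    and Y: "compact_space Y" "topspace Y \<noteq> {}"
  shows INF_compact_attained:
      "\<And>x. x \<in> topspace X \<Longrightarrow> \<exists>y\<in>topspace Y. (INF y\<in>topspace Y. f (x, y)) = f (x, y) \<and>
         (\<forall>z\<in>topspace Y. f (x, y) \<le> f (x, z))"
    and continuous_map_INF_compact: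
      "continuous_map X euclideanreal (\<lambda>x. INF y\<in>topspace Y. f (x, y))"
proof -
  let ?m = "\<lambda>x. INF y\<in>topspace Y. f (x, y)"
  show att: "\<exists>y\<in>topspace Y. ?m x = f (x, y) \<and> (\<forall>z\<in>topspace Y. f (x, y) \<le> f (x, z))"
    if x: "x \<in> topspace X" for x
  proof -
    have "continuous_map Y euclideanreal (f \<circ> (\<lambda>y. (x, y)))"
      using x by (intro continuous_map_compose[OF _ f] continuous_map_pairedI) auto
    then have "compact ((f \<circ> (\<lambda>y. (x, y))) ` topspace Y)"
      using image_compactin[of Y "topspace Y" euclideanreal] Y(1)
      unfolding compact_space_def compactin_euclidean_iff by blast
    then obtain y where y: "y \<in> topspace Y" "\<forall>z\<in>topspace Y. f (x, y) \<le> f (x, z)"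
      using compact_attains_inf[of "(f \<circ> (\<lambda>y. (x, y))) ` topspace Y"] Y(2) by auto
    then have "?m x = f (x, y)"
      by (intro cInf_eq_minimum) auto
    with y show ?thesis
      by blast
  qed
  have less: "{x \<in> topspace X. ?m x < a} = fst ` {p \<in> topspace (prod_topology X Y). f p < a}" for a
  proof (intro set_eqI iffI)
    fix x assume "x \<in> {x \<in> topspace X. ?m x < a}"
    then show "x \<in> fst ` {p \<in> topspace (prod_topology X Y). f p < a}"
      using att[of x] by (auto intro!: image_eqI[of _ fst "(x, _)"])
  next
    fix x assume "x \<in> fst ` {p \<in> topspace (prod_topology X Y). f p < a}"
    then obtain y where "x \<in> topspace X" "y \<in> topspace Y" "f (x, y) < a"
      by auto
    then show "x \<in> {x \<in> topspace X. ?m x < a}"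
      using att[of x] le_less_trans by fastforce
  qed
  \<comment> \<open>Here a minimiser is essential: an infimum equal to \<open>a\<close> must be
    reached to lift the point to the product.\<close>
  have le: "{x \<in> topspace X. ?m x \<le> a} = fst ` {p \<in> topspace (prod_topology X Y). f p \<le> a}" for a
  proof (intro set_eqI iffI)
    fix x assume "x \<in> {x \<in> topspace X. ?m x \<le> a}"
    then show "x \<in> fst ` {p \<in> topspace (prod_topology X Y). f p \<le> a}"
      using att[of x] by (auto intro!: image_eqI[of _ fst "(x, _)"])
  next
    fix x assume "x \<in> fst ` {p \<in> topspace (prod_topology X Y). f p \<le> a}"
    then obtain y where "x \<in> topspace X" "y \<in> topspace Y" "f (x, y) \<le> a"
      by auto
    then show "x \<in> {x \<in> topspace X. ?m x \<le> a}"
      using att[of x] order_trans by fastforce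
  qed
  have f': "openin (prod_topology X Y) {p \<in> topspace (prod_topology X Y). f p < a}"
      "closedin (prod_topology X Y) {p \<in> topspace (prod_topology X Y). f p \<le> a}" for a
    using f unfolding continuous_map_upper_lower_semicontinuous_lte by blast+
  show "continuous_map X euclideanreal ?m"
    unfolding continuous_map_upper_lower_semicontinuous_lte less le
    using f' open_map_fst[of X Y] closed_map_fst[OF Y(1), of X]
    unfolding open_map_def closed_map_def by blast
qed

lemma second_countable_prod_topology:
  assumes "second_countable X" "second_countable Y"
  shows "second_countable (prod_topology X Y)"
proof -
  obtain \<A> where \<A>: "countable \<A>" "\<And>V. V \<in> \<A> \<Longrightarrow> openin X V"
      "\<And>U x. openin X U \<Longrightarrow> x \<in> U \<Longrightarrow> \<exists>V \<in> \<A>. x \<in> V \<and> V \<subseteq> U"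
    using assms(1) unfolding second_countable_def by metis
  obtain \<B> where \<B>: "countable \<B>" "\<And>V. V \<in> \<B> \<Longrightarrow> openin Y V"
      "\<And>U x. openin Y U \<Longrightarrow> x \<in> U \<Longrightarrow> \<exists>V \<in> \<B>. x \<in> V \<and> V \<subseteq> U"
    using assms(2) unfolding second_countable_def by metis
  let ?C = "(\<lambda>(A, B). A \<times> B) ` (\<A> \<times> \<B>)"
  have cC: "countable ?C"
    using \<A>(1) \<B>(1) by blast
  have oC: "openin (prod_topology X Y) V" if "V \<in> ?C" for V
    using that \<A>(2) \<B>(2) by (auto simp: openin_prod_Times_iff)
  have bC: "\<exists>V\<in>?C. p \<in> V \<and> V \<subseteq> U" if U: "openin (prod_topology X Y) U" "p \<in> U" for U p
  proof -
    obtain x y where p: "p = (x, y)"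
      by fastforce
    obtain U1 U2 where "openin X U1" "openin Y U2" "x \<in> U1" "y \<in> U2" "U1 \<times> U2 \<subseteq> U"
      using openin_prod_topology_alt[THEN iffD1, rule_format, OF U(1) U(2)[unfolded p]] by blast
    moreover from \<open>openin X U1\<close> \<open>x \<in> U1\<close> obtain A where "A \<in> \<A>" "x \<in> A" "A \<subseteq> U1"
      using \<A>(3) by blast
    moreover obtain B where "B \<in> \<B>" "y \<in> B" "B \<subseteq> U2"
      using \<B>(3)[OF \<open>openin Y U2\<close> \<open>y \<in> U2\<close>] by blast
    ultimately have "A \<times> B \<in> ?C" "p \<in> A \<times> B" "A \<times> B \<subseteq> U"
      using p by auto
    then show ?thesis
      by meson
  qed
  show ?thesis
    unfolding second_countable_def
    by (intro exI[of _ ?C] conjI ballI allI impI cC) (erule oC, elim conjE, erule (1) bC)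
qed

lemma second_countable_euclidean:
  "second_countable (euclidean :: 'a::second_countable_topology topology)"
proof -
  obtain B :: "'a set set" where "countable B" "topological_basis B"
    using ex_countable_basis by blast
  then show ?thesis
    unfolding second_countable_def
    by (metis open_openin topological_basisE topological_basis_open)
qed

lemma metrizable_closedin_zero_set:
  assumes X: "metrizable_space X" and A: "closedin X A"
  obtains a where "continuous_map X euclideanreal a"
    and "\<And>x. x \<in> topspace X \<Longrightarrow> 0 \<le> a x"
    and "\<And>x. x \<in> topspace X \<Longrightarrow> a x = 0 \<longleftrightarrow> x \<in> A"
proof (cases "A = {}")
  case True
  \<comment> \<open>The infimum defining the distance would range over the empty set; the constant 1
    has empty zero set.\<close>
  then show ?thesis
    using that[of "\<lambda>_. 1"] by simp
next
  case False
  obtain M d where "Metric_space M d" and Xd: "X = Metric_space.mtopology M d"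
    using X unfolding metrizable_space_def by blast
  interpret Metric_space M d
    by fact
  have AM: "A \<subseteq> M"
    using closedin_subset[OF A] Xd by simp
  define a where "a x = (INF b\<in>A. d x b)" for x
  have a_le: "a x \<le> d x b" if "b \<in> A" for x b
    unfolding a_def using that by (intro cINF_lower bdd_belowI2[of _ 0]) auto
  have a_nn: "0 \<le> a x" for x
    unfolding a_def using False by (intro cINF_greatest) auto
  have tri: "a x \<le> d x z + a z" if "x \<in> M" "z \<in> M" for x z
  proof -
    have "a x - d x z \<le> d z b" if b: "b \<in> A" for b
      using a_le[OF b, of x] triangle[OF \<open>x \<in> M\<close> \<open>z \<in> M\<close> subsetD[OF AM b]] by linarith
    then have "a x - d x z \<le> a z"
      unfolding a_def[of z] using False by (intro cINF_greatest) auto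
    then show ?thesis
      by linarith
  qed
  have "continuous_map X euclideanreal a"
    unfolding Xd by (intro continuous_map_of_le_add_dist tri)
  moreover have "a x = 0 \<longleftrightarrow> x \<in> A" if x: "x \<in> topspace X" for x
  proof
    assume "x \<in> A"
    then show "a x = 0"
      using a_le[of x x] a_nn[of x] AM by auto
  next
    assume a0: "a x = 0"
    show "x \<in> A"
    proof (rule ccontr)
      assume "x \<notin> A"
      then have "openin X (M - A)" "x \<in> M - A"
        using openin_diff[OF openin_topspace A] x Xd by auto
      then obtain r where r: "r > 0" "mball x r \<subseteq> M - A"
        using Xd by (auto simp: openin_mtopology)
      have "r \<le> d x b" if "b \<in> A" for b
        using that r(2) AM x Xd by (force simp: in_mball)
      then have "r \<le> a x"
        unfolding a_def using False by (intro cINF_greatest) auto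
      then show False
        using r a0 by simp
    qed
  qed
  ultimately show ?thesis
    using that a_nn by blast
qed

section \<open>Homotopy extension with a parameter\<close>

lemma closedin_homotopy_extension_domain:
  assumes "closedin X A"
  shows "closedin (prod_topology X (top_of_set {0..1::real})) (A \<times> {0..1} \<union> topspace X \<times> {0})"
proof -
  have "closedin (top_of_set {0..1::real}) {0..1}" "closedin (top_of_set {0..1::real}) {0}"
    by (auto simp: closedin_closed_subtopology)
  then show ?thesis
    using assms by (intro closedin_Un) (auto simp: closedin_prod_Times_iff)
qed

text \<open>Dugundji's theorem gives an extension \<^term>\<open>G\<close> of \<^term>\<open>g\<close> with values in the ambient Banach
  space. Over \<^term>\<open>(t, x)\<close> the time is slowed down by a factor \<^term>\<open>u (t, x)\<close>, which is
  \<^term>\<open>1::real\<close> over \<^term>\<open>A\<close> and vanishes as soon as the path \<^term>\<open>\<lambda>s. G (t, (x, s))\<close> leaves the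
  domain of the retraction.\<close>

theorem homotopy_extension_parametrized:
  fixes X :: "'a topology" and T :: "'t topology" and K :: "nat set set"
  assumes K: "abstract_simplicial_complex K" "locally_finite_complex K"
    and X: "metrizable_space X" "second_countable X" and A: "closedin X A"
  defines "I \<equiv> top_of_set {0..1::real}"
  defines "D \<equiv> A \<times> {0..1} \<union> topspace X \<times> {0}"
  assumes g: "continuous_map (prod_topology T (subtopology (prod_topology X I) D)) (realization K) g"
  obtains H where "continuous_map (prod_topology T (prod_topology X I)) (realization K) H"
    and "\<And>t z. t \<in> topspace T \<Longrightarrow> z \<in> D \<Longrightarrow> H (t, z) = g (t, z)"
proof -
  have topI: "topspace I = {0..1}"
    by (simp add: I_def)
  have compI: "compact_space I"
    by (simp add: I_def compact_space_subtopology)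
  have AX: "A \<subseteq> topspace X"
    using closedin_subset[OF A] .
  have DXI: "D \<subseteq> topspace (prod_topology X I)"
    using AX by (auto simp: D_def topI)
  have metI: "metrizable_space I"
    unfolding I_def by (intro metrizable_space_subtopology metrizable_space_euclidean)
  have Z: "metrizable_space (prod_topology X I)" "second_countable (prod_topology X I)"
    using X metI second_countable_subtopology[OF second_countable_euclidean]
    by (auto simp: metrizable_space_prod_topology I_def intro!: second_countable_prod_topology)
  have clD: "closedin (prod_topology X I) D"
    unfolding I_def D_def using closedin_homotopy_extension_domain[OF A] .
  have g_real: "g (t, z) \<in> realization_points K" if "t \<in> topspace T" "z \<in> D" for t z
    using continuous_map_image_subset_topspace[OF g] that DXI by (auto simp: topspace_realization)
  \<comment> \<open>The bound 1 holds because barycentric coordinates lie between 0 and 1.\<close>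
  obtain G where G: "continuous_map (prod_topology T (prod_topology X I)) euclidean G"
    and Gg: "\<And>t z. t \<in> topspace T \<Longrightarrow> z \<in> D \<Longrightarrow> G (t, z) = Bcontfun (g (t, z))"
    using Dugundji_parametrized[OF Z clD, of T "Bcontfun \<circ> g" 1]
      continuous_map_compose[OF g continuous_map_Bcontfun_realization[OF K]]
      norm_Bcontfun_realization_point[OF K(1) g_real] by auto
  obtain a where a: "continuous_map X euclideanreal a"
    "\<And>x. x \<in> topspace X \<Longrightarrow> 0 \<le> a x" "\<And>x. x \<in> topspace X \<Longrightarrow> a x = 0 \<longleftrightarrow> x \<in> A"
    using metrizable_closedin_zero_set[OF X(1) A] by blast
  \<comment> \<open>With the gap clipped at 0, the minimum \<open>m p\<close> is nonnegative, and it
    is positive exactly when the whole path over \<open>p\<close> stays in the domain of the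
    retraction.\<close>
  define n where "n = (\<lambda>((t, x), s). max 0 (gap K (G (t, (x, s)))))"
  define m where "m p = (INF s\<in>topspace I. n (p, s))" for p
  \<comment> \<open>A Urysohn-type quotient: 1 where \<open>a\<close> vanishes, 0 where
    \<open>m\<close> vanishes. Both cannot vanish together, since \<open>m\<close> is positive over
    \<open>A\<close>.\<close>
  define u where "u = (\<lambda>(t, x). m (t, x) / (m (t, x) + a x))"
  define \<Phi> where "\<Phi> = (\<lambda>(t, (x, s)). G (t, (x, s * u (t, x))))"
  let ?TX = "prod_topology T X"
  have n_cont: "continuous_map (prod_topology ?TX I) euclideanreal n"
  proof -
    have "continuous_map (prod_topology ?TX I) euclidean
        (G \<circ> (\<lambda>q. (fst (fst q), (snd (fst q), snd q))))"
      using continuous_map_compose[OF continuous_map_fst continuous_map_fst]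
        continuous_map_compose[OF continuous_map_fst continuous_map_snd]
      by (intro continuous_map_compose[OF _ G] continuous_map_pairedI continuous_map_snd)
         (auto simp: o_def)
    then have "continuous_map (prod_topology ?TX I) euclideanreal
        ((\<lambda>y. gap K (apply_bcontfun y)) \<circ> (G \<circ> (\<lambda>q. (fst (fst q), (snd (fst q), snd q)))))"
      by (rule continuous_map_compose) (simp add: continuous_on_gap)
    then have "continuous_map (prod_topology ?TX I) euclideanreal
        (\<lambda>q. max 0 (gap K (G (fst (fst q), (snd (fst q), snd q)))))"
      by (intro continuous_map_real_max) (auto simp: o_def)
    then show ?thesis
      by (simp add: n_def case_prod_unfold)
  qed
  have I_ne: "topspace I \<noteq> {}"
    by (simp add: topI)
  have m_cont: "continuous_map ?TX euclideanreal m"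
    unfolding m_def using continuous_map_INF_compact[OF n_cont compI I_ne] .
  have m_att: "\<exists>s\<in>{0..1}. m p = n (p, s) \<and> (\<forall>s'\<in>{0..1}. n (p, s) \<le> n (p, s'))"
    if "p \<in> topspace ?TX" for p
    using INF_compact_attained[OF n_cont compI I_ne that] by (simp add: m_def topI)
  have m_nn: "0 \<le> m p" if "p \<in> topspace ?TX" for p
    using m_att[OF that] by (auto simp: n_def split: prod.splits)
  have gapD: "0 < gap K (G (t, z))" if "t \<in> topspace T" "z \<in> D" for t z
    using gap_realization_point[OF K(1) g_real[OF that]] Gg[OF that] by simp
  \<comment> \<open>Over \<open>A\<close> the whole path lies in \<open>D\<close>, where
    \<open>G\<close> takes values in the embedded realization. Attainment of the infimum makes it
    positive and not merely nonnegative.\<close>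
  have m_pos: "0 < m (t, x)" if "t \<in> topspace T" "x \<in> A" for t x
  proof -
    have "(t, x) \<in> topspace ?TX"
      using that AX by auto
    then obtain s where s: "s \<in> {0..1}" "m (t, x) = n ((t, x), s)"
      using m_att by blast
    then have "0 < gap K (G (t, (x, s)))"
      using that by (intro gapD) (auto simp: D_def)
    then show ?thesis
      using s by (simp add: n_def)
  qed
  have denom: "0 < m (t, x) + a x" if "t \<in> topspace T" "x \<in> topspace X" for t x
    using m_pos[of t x] m_nn[of "(t, x)"] a(2,3)[OF that(2)] that
    by (cases "x \<in> A") (auto simp: add_pos_nonneg add_nonneg_pos order_less_le)
  have u_cont: "continuous_map ?TX euclideanreal u"
  proof -
    have "continuous_map ?TX euclideanreal (a \<circ> snd)"
      by (intro continuous_map_compose[OF continuous_map_snd a(1)])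
    then have "continuous_map ?TX euclideanreal (\<lambda>p. m p / (m p + a (snd p)))"
      using denom by (intro continuous_map_real_divide continuous_map_add m_cont) (force simp: o_def)+
    then show ?thesis
      by (simp add: u_def case_prod_unfold)
  qed
  have u01: "0 \<le> u (t, x)" "u (t, x) \<le> 1" if "t \<in> topspace T" "x \<in> topspace X" for t x
    using denom[OF that] m_nn[of "(t, x)"] a(2)[OF that(2)] that by (auto simp: u_def)
  have u1: "u (t, x) = 1" if "t \<in> topspace T" "x \<in> A" for t x
    using m_pos[OF that] a(3)[of x] that AX by (auto simp: u_def)
  let ?TXI = "prod_topology T (prod_topology X I)"
  have su01: "s * u (t, x) \<in> {0..1}"
    if "t \<in> topspace T" "x \<in> topspace X" "s \<in> {0..1}" for t x s
    using u01[OF that(1,2)] that(3) mult_le_one[of s "u (t, x)"] by auto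
  have \<Phi>_cont: "continuous_map ?TXI euclidean \<Phi>"
  proof -
    have x: "continuous_map ?TXI X (\<lambda>q. fst (snd q))"
      using continuous_map_compose[OF continuous_map_snd continuous_map_fst] by (simp add: o_def)
    have s: "continuous_map ?TXI I (\<lambda>q. snd (snd q))"
      using continuous_map_compose[OF continuous_map_snd continuous_map_snd] by (simp add: o_def)
    have "continuous_map ?TXI euclideanreal (u \<circ> (\<lambda>q. (fst q, fst (snd q))))"
      by (intro continuous_map_compose[OF _ u_cont] continuous_map_pairedI continuous_map_fst x)
    then have "continuous_map ?TXI euclideanreal (\<lambda>q. snd (snd q) * u (fst q, fst (snd q)))"
      using continuous_map_into_fulltopology[OF s[unfolded I_def]] unfolding I_def
      by (intro continuous_map_real_mult) (auto simp: o_def)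
    then have "continuous_map ?TXI I (\<lambda>q. snd (snd q) * u (fst q, fst (snd q)))"
      using su01 by (auto simp: I_def continuous_map_in_subtopology)
    then have "continuous_map ?TXI euclidean
        (G \<circ> (\<lambda>q. (fst q, (fst (snd q), snd (snd q) * u (fst q, fst (snd q))))))"
      by (intro continuous_map_compose[OF _ G] continuous_map_pairedI continuous_map_fst x)
    then show ?thesis
      by (simp add: \<Phi>_def case_prod_unfold o_def)
  qed
  have gap\<Phi>: "0 < gap K (\<Phi> q)" if q: "q \<in> topspace ?TXI" for q
  proof -
    obtain t x s where q_eq: "q = (t, (x, s))" and t: "t \<in> topspace T" and x: "x \<in> topspace X"
      and s: "s \<in> {0..1}"
      using q topI by auto
    show ?thesis
    \<comment> \<open>A stopped path stays at time 0, where \<open>(x, 0)\<close> lies in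
      \<open>D\<close>. Otherwise \<open>m (t, x)\<close> is positive, and every time on the path is
      admissible.\<close>
    proof (cases "u (t, x) = 0")
      case True
      then show ?thesis
        using gapD[of t "(x, 0)"] t x by (simp add: \<Phi>_def q_eq D_def)
    next
      case False
      then have "0 < m (t, x)"
        using m_nn[of "(t, x)"] t x by (auto simp: u_def order_less_le)
      then have "0 < n ((t, x), s * u (t, x))"
        using m_att[of "(t, x)"] su01[OF t x s] t x by fastforce
      then show ?thesis
        by (simp add: n_def \<Phi>_def q_eq less_max_iff_disj)
    qed
  qed
  have "simplicial_retraction K (\<Phi> (t, z)) = g (t, z)" if t: "t \<in> topspace T" and z: "z \<in> D" for t z
  proof -
    \<comment> \<open>Slowing down changes nothing on \<open>D\<close>: time 0 is fixed by every
      factor, and over \<open>A\<close> the factor is 1.\<close>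
    obtain x s where "z = (x, s)" "s = 0 \<or> x \<in> A"
      using z by (auto simp: D_def)
    then have "\<Phi> (t, z) = G (t, z)"
      using u1[OF t] by (auto simp: \<Phi>_def)
    then show ?thesis
      using Gg[OF t z] simplicial_retraction_realization_point[OF K(1) g_real[OF t z]] by simp
  qed
  then show ?thesis
    using that continuous_map_simplicial_retraction[OF K \<Phi>_cont gap\<Phi>] by blast
qed

section \<open>Evaluation and currying for the compact-open topology\<close>

text \<open>Inside the open preimage of \<open>U\<close> under \<open>g\<close>, the point
  \<open>y\<close> has a compact neighbourhood \<open>C\<close>. The maps sending \<open>C\<close>
  into \<open>U\<close> form a subbasic neighbourhood of \<open>g\<close>, and evaluating any of
  them near \<open>y\<close> stays in \<open>U\<close>.\<close>

lemma continuous_map_evaluation: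
  assumes "locally_compact_space Y" "Hausdorff_space Y"
  shows "continuous_map (prod_topology (compact_open_topology Y P) Y) P (\<lambda>(g, y). g y)"
  unfolding continuous_map
proof (intro conjI allI impI)
  show "(\<lambda>(g, y). g y) ` topspace (prod_topology (compact_open_topology Y P) Y) \<subseteq> topspace P"
    by (auto simp: topspace_compact_open_topology Map_def continuous_map_def)
  fix U assume U: "openin P U"
  let ?T = "compact_open_topology Y P"
  let ?W = "{p \<in> topspace (prod_topology ?T Y). (case p of (g, y) \<Rightarrow> g y) \<in> U}"
  have nb: "neighbourhood_base_of (compactin Y) Y"
    using assms locally_compact_space_neighbourhood_base by blast
  show "openin (prod_topology ?T Y) ?W"
  proof (subst openin_subopen, intro ballI)
    fix p assume p: "p \<in> ?W"
    obtain g y where gy: "p = (g, y)" "g \<in> Map Y P" "y \<in> topspace Y" "g y \<in> U"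
      using p by (auto simp: topspace_compact_open_topology)
    have "openin Y {z \<in> topspace Y. g z \<in> U}"
      using gy(2) U unfolding Map_def by (auto intro: openin_continuous_map_preimage)
    then obtain V C where V: "openin Y V" "compactin Y C" "y \<in> V" "V \<subseteq> C"
        "C \<subseteq> {z \<in> topspace Y. g z \<in> U}"
      using nb gy unfolding neighbourhood_base_of by (metis (mono_tags, lifting) mem_Collect_eq)
    let ?N = "{f \<in> Map Y P. f ` C \<subseteq> U}"
    have "openin ?T ?N"
      unfolding compact_open_topology_def using V(2) U by (intro topology_generated_by_Basis) blast
    then have "openin (prod_topology ?T Y) (?N \<times> V)"
      using V(1) by (simp add: openin_prod_Times_iff)
    moreover have "p \<in> ?N \<times> V"
      using gy V by auto
    moreover have "?N \<times> V \<subseteq> ?W"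
      using V(4) openin_subset[OF V(1)] by (auto simp: topspace_compact_open_topology image_subset_iff)
    ultimately show "\<exists>W. openin (prod_topology ?T Y) W \<and> p \<in> W \<and> W \<subseteq> ?W"
      by blast
  qed
qed

text \<open>If \<open>h\<close> sends \<open>{s} \<times> C\<close> into an open set with
  \<open>C\<close> compact, the tube lemma extends this to all parameters near \<open>s\<close>,
  which is continuity with respect to subbasic sets.\<close>

lemma continuous_map_curry_compact_open:
  assumes h: "continuous_map (prod_topology S Z) P h"
  shows "continuous_map S (compact_open_topology Z P)
     (\<lambda>s. restrict (\<lambda>z. h (s, z)) (topspace Z))" (is "continuous_map S _ ?E")
proof -
  have E: "?E s \<in> Map Z P" if "s \<in> topspace S" for s
  proof -
    have "continuous_map Z P (h \<circ> (\<lambda>z. (s, z)))"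
      using that by (intro continuous_map_compose[OF _ h] continuous_map_pairedI) auto
    then have "continuous_map Z P (?E s)"
      by (rule continuous_map_eq) auto
    then show ?thesis
      by (simp add: Map_def)
  qed
  show ?thesis
    unfolding compact_open_topology_def
  proof (rule continuous_on_generated_topo)
    have "Map Z P \<in> {{f \<in> Map Z P. f ` C \<subseteq> U} | C U. compactin Z C \<and> openin P U}"
      by (intro CollectI exI[of _ "{}"]) auto
    then show "?E ` topspace S \<subseteq> \<Union>{{f \<in> Map Z P. f ` C \<subseteq> U} | C U. compactin Z C \<and> openin P U}"
      using E by blast
    fix N assume "N \<in> {{f \<in> Map Z P. f ` C \<subseteq> U} | C U. compactin Z C \<and> openin P U}"
    then obtain C U where N: "N = {f \<in> Map Z P. f ` C \<subseteq> U}" and C: "compactin Z C"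
      and U: "openin P U"
      by blast
    let ?W = "{p \<in> topspace (prod_topology S Z). h p \<in> U}"
    have W: "openin (prod_topology S Z) ?W"
      using h U by (rule openin_continuous_map_preimage)
    have CZ: "C \<subseteq> topspace Z"
      using C compactin_subset_topspace by blast
    show "openin S (?E -` N \<inter> topspace S)"
    proof (subst openin_subopen, intro ballI)
      fix s assume s: "s \<in> ?E -` N \<inter> topspace S"
      then have "h (s, z) \<in> U" if "z \<in> C" for z
        using that CZ by (auto simp: N image_subset_iff split: if_splits)
      then have sub: "{s} \<times> C \<subseteq> ?W"
        using s CZ by auto
      have "s \<in> topspace S"
        using s by blast
      from tube_lemma_right[OF W C this sub]
      obtain V V' where V: "openin S V" "s \<in> V" "C \<subseteq> V'" "V \<times> V' \<subseteq> ?W"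
        by blast
      have "V \<subseteq> ?E -` N \<inter> topspace S"
      proof
        fix s' assume s': "s' \<in> V"
        then have "h (s', z) \<in> U" if "z \<in> C" for z
          using that V(3,4) by auto
        then have "?E s' ` C \<subseteq> U"
          using CZ by auto
        then show "s' \<in> ?E -` N \<inter> topspace S"
          using E[of s'] s' openin_subset[OF V(1)] by (auto simp: N)
      qed
      with V show "\<exists>T. openin S T \<and> s \<in> T \<and> T \<subseteq> ?E -` N \<inter> topspace S"
        by blast
    qed
  qed
qed

section \<open>Borel choice of the extended homotopy\<close>

lemma measurable_borel_of:
  assumes "continuous_map S T f"
  shows "f \<in> borel_of S \<rightarrow>\<^sub>M borel_of T"
  unfolding borel_of_def[of T]
proof (rule measurable_measure_of)
  show "{U. openin T U} \<subseteq> Pow (topspace T)"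
    using openin_subset by blast
  show "f \<in> space (borel_of S) \<rightarrow> topspace T"
    using assms by (auto simp: space_borel_of continuous_map_def)
  fix U assume "U \<in> {U. openin T U}"
  then have "openin S {x \<in> topspace S. f x \<in> U}"
    using assms openin_continuous_map_preimage by blast
  moreover have "f -` U \<inter> space (borel_of S) = {x \<in> topspace S. f x \<in> U}"
    by (auto simp: space_borel_of)
  ultimately show "f -` U \<inter> space (borel_of S) \<in> sets (borel_of S)"
    by (simp add: sets_borel_of sigma_sets.Basic)
qed

theorem theorem6p4:
  fixes X :: "'a topology" and P :: "'b topology" and A :: "'a set"
    and I :: "real topology" and XI Y :: "('a \<times> real) topology"
  assumes "Polish_space X" and "locally_compact_space X"
    and "closedin X A"
    and "polyhedron_space P"
  defines "I \<equiv> top_of_set {0..1}"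
  defines "XI \<equiv> prod_topology X I"
  defines "Y \<equiv> subtopology XI (A \<times> {0..1} \<union> topspace X \<times> {0})"
  shows "(\<forall>g. continuous_map Y P g \<longrightarrow>
            (\<exists>h. continuous_map XI P h \<and> (\<forall>y \<in> topspace Y. h y = g y))) \<and>
         (\<exists>E. E \<in> borel_of (compact_open_topology Y P)
                 \<rightarrow>\<^sub>M borel_of (compact_open_topology XI P) \<and>
              (\<forall>g \<in> Map Y P. \<forall>y \<in> topspace Y. E g y = g y))"
proof -
  let ?D = "A \<times> {0..1} \<union> topspace X \<times> {0}" and ?T = "compact_open_topology Y P"
  have X: "metrizable_space X" "second_countable X"
    using assms(1) completely_metrizable_imp_metrizable_space by (auto simp: Polish_space_def)
  obtain K :: "nat set set" where K: "abstract_simplicial_complex K" "locally_finite_complex K"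
    and hom: "P homeomorphic_space realization K"
    using assms(4) unfolding polyhedron_space_def by blast
  obtain \<phi> \<psi> where \<phi>: "continuous_map P (realization K) \<phi>" and \<psi>: "continuous_map (realization K) P \<psi>"
    and \<psi>\<phi>: "\<And>x. x \<in> topspace P \<Longrightarrow> \<psi> (\<phi> x) = x"
    using hom unfolding homeomorphic_space_def homeomorphic_maps_def by blast
  have "?D \<subseteq> topspace XI"
    using closedin_subset[OF assms(3)] by (auto simp: XI_def I_def)
  then have topY: "topspace Y = ?D"
    by (auto simp: Y_def)
  have "closedin XI ?D"
    unfolding XI_def I_def using closedin_homotopy_extension_domain[OF assms(3)] .
  moreover have "locally_compact_space I"
    unfolding I_def
    by (intro compact_imp_locally_compact_space) (simp add: compact_space_subtopology)
  then have "locally_compact_space XI"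
    using assms(2) by (simp add: XI_def locally_compact_space_prod_topology)
  ultimately have lcY: "locally_compact_space Y"
    unfolding Y_def using locally_compact_space_closed_subset by blast
  have "Hausdorff_space Y"
    unfolding Y_def XI_def I_def using metrizable_imp_Hausdorff_space[OF X(1)]
    by (intro Hausdorff_space_subtopology)
       (simp add: Hausdorff_space_prod_topology Hausdorff_space_subtopology)
  then have ev: "continuous_map (prod_topology ?T Y) P (\<lambda>(g, y). g y)"
    by (rule continuous_map_evaluation[OF lcY])
  \<comment> \<open>All maps \<open>g\<close> are extended at once: the parameter is
    \<open>g\<close> itself, and the partial homotopy is evaluation followed by the homeomorphism to
    the realization.\<close>
  obtain H where H: "continuous_map (prod_topology ?T XI) (realization K) H"
    and Hg: "\<And>g y. g \<in> topspace ?T \<Longrightarrow> y \<in> ?D \<Longrightarrow> H (g, y) = (\<phi> \<circ> (\<lambda>(g, y). g y)) (g, y)"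
    using homotopy_extension_parametrized[OF K X assms(3), of ?T "\<phi> \<circ> (\<lambda>(g, y). g y)"]
      continuous_map_compose[OF ev \<phi>] unfolding Y_def XI_def I_def by blast
  \<comment> \<open>The restriction makes each value extensional, as membership in
    \<open>Map\<close> demands.\<close>
  define E where "E g = restrict (\<lambda>z. (\<psi> \<circ> H) (g, z)) (topspace XI)" for g
  have E_cont: "continuous_map ?T (compact_open_topology XI P) E"
    unfolding E_def
    by (intro continuous_map_curry_compact_open continuous_map_compose[OF H \<psi>])
  have E_ext: "E g y = g y" if g: "g \<in> Map Y P" and y: "y \<in> topspace Y" for g y
  proof -
    have "g y \<in> topspace P"
      using g y by (auto simp: Map_def continuous_map_def)
    then show ?thesis
      using y topY Hg[of g y] g \<psi>\<phi> \<open>?D \<subseteq> topspace XI\<close>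
      by (auto simp: E_def topspace_compact_open_topology)
  qed
  have "\<exists>h. continuous_map XI P h \<and> (\<forall>y \<in> topspace Y. h y = g y)" if g: "continuous_map Y P g" for g
  proof -
    \<comment> \<open>An arbitrary continuous \<open>g\<close> need not be extensional; its
      restriction is a point of the parameter space and has the same values on
      \<open>Y\<close>.\<close>
    let ?g = "restrict g (topspace Y)"
    have "continuous_map Y P ?g"
      using g by (rule continuous_map_eq) auto
    then have g': "?g \<in> Map Y P"
      by (simp add: Map_def)
    then have "E ?g \<in> Map XI P"
      using continuous_map_image_subset_topspace[OF E_cont]
      by (auto simp: topspace_compact_open_topology)
    then show ?thesis
      using E_ext[OF g'] by (auto simp: Map_def intro!: exI[of _ "E ?g"])
  qed
  moreover have "E \<in> borel_of ?T \<rightarrow>\<^sub>M borel_of (compact_open_topology XI P)"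
    using E_cont by (rule measurable_borel_of)
  ultimately show ?thesis
    using E_ext by blast
qed

end
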